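(* Let $f\in\mathbb{R}[\underline{x}]$ be a convex polynomial on $\mathbb{R}^n$. If $\nabla^2 f(x_0)\succ 0$ at some point $x_0\in\mathbb{R}^n$, then $f$ is coercive and strictly convex on $\mathbb{R}^n$.
   Context: $\mathbb{R}[\underline{x}]$ is the ring of real polynomials in $x=(x_1,\ldots,x_n)$. $\nabla^2 f(x_0)$ is the Hessian of $f$ at $x_0$, and $\succ 0$ means positive definite. A function $f:\mathbb{R}^n\to\mathbb{R}$ is coercive on $\mathbb{R}^n$ if $\liminf_{\|x\|\to\infty}f(x)=+\infty$. *)

theory Defs
  imports "HOL-Analysis.Analysis"
begin

definition partial_deriv :: "'n::finite \<Rightarrow> (real ^ 'n \<Rightarrow> real) \<Rightarrow> real ^ 'n \<Rightarrow> real" where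
  "partial_deriv i f x = deriv (\<lambda>t. f (x + t *\<^sub>R axis i 1)) 0"

definition hessian :: "(real ^ 'n::finite \<Rightarrow> real) \<Rightarrow> real ^ 'n \<Rightarrow> real ^ 'n ^ 'n" where
  "hessian f x = (\<chi> i j. partial_deriv i (partial_deriv j f) x)"

(* As usual for real matrices, positive definiteness includes symmetry; the Hessian of a
   polynomial is always symmetric, so for Hessians of polynomials this is no restriction. *)
definition pos_definite :: "real ^ 'n ^ 'n::finite \<Rightarrow> bool" where
  "pos_definite A \<longleftrightarrow> transpose A = A \<and> (\<forall>v. v \<noteq> 0 \<longrightarrow> v \<bullet> (A *v v) > 0)"

(* The limit inferior is taken in the extended reals; the filter at_infinity is the one of
   norm x tending to infinity. *)
definition coercive :: "('a::real_normed_vector \<Rightarrow> real) \<Rightarrow> bool" where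
  "coercive f \<longleftrightarrow> Liminf at_infinity (\<lambda>x. ereal (f x)) = \<infinity>"

definition strictly_convex_on :: "'a::real_vector set \<Rightarrow> ('a \<Rightarrow> real) \<Rightarrow> bool" where
  "strictly_convex_on S f \<longleftrightarrow> convex S \<and>
    (\<forall>x\<in>S. \<forall>y\<in>S. \<forall>u>0. \<forall>v>0. x \<noteq> y \<longrightarrow> u + v = 1 \<longrightarrow>
      f (u *\<^sub>R x + v *\<^sub>R y) < u * f x + v * f y)"

end

theory Submission
  imports Defs
begin

text \<open>
  The idea is that both conclusions can only fail if \<open>f\<close> is affine on some line, and that an
  affine line contradicts the positive definiteness of the Hessian.

  Along any line, \<open>f\<close> restricts to a convex univariate polynomial. If strict convexity fails, then
  \<open>f\<close> coincides with its chord on a segment, hence on the whole line. If coercivity fails, then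
  some sublevel set of \<open>f\<close> is unbounded, and by compactness of the unit sphere \<open>f\<close> is bounded
  above on a ray; a convex polynomial that is bounded above on a ray grows at most linearly there
  and so has degree at most one.

  Suppose now that \<open>f\<close> is affine with slope \<open>b\<close> on a line with direction \<open>d \<noteq> 0\<close>. By convexity
  and continuity \<open>f (z + t d) = f z + b t\<close> for all \<open>z\<close> and \<open>t\<close>
  (lemma \<open>convex_affine_on_line_imp_translation\<close>). Hence each first partial derivative of \<open>f\<close> is
  invariant under translations along \<open>d\<close>, so \<open>d\<close> lies in the left kernel of the Hessian of \<open>f\<close> at
  every point (lemma \<open>hessian_left_kernel_of_translation\<close>), and no Hessian of \<open>f\<close> is positive
  definite.
\<close>

section \<open>Polynomials on lines\<close>

lemma real_polynomial_function_on_line: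
  assumes "real_polynomial_function f"
  shows "\<exists>p. \<forall>t. f (x + t *\<^sub>R d) = poly p t"
  using assms
proof induction
  case (linear f)
  then interpret bounded_linear f .
  show ?case
    by (rule exI[of _ "[:f x, f d:]"]) (simp add: add scaleR)
next
  case (const c)
  show ?case by (rule exI[of _ "[:c:]"]) simp
next
  case (add f g)
  then obtain p q where "\<forall>t. f (x + t *\<^sub>R d) = poly p t" "\<forall>t. g (x + t *\<^sub>R d) = poly q t"
    by blast
  then show ?case by (intro exI[of _ "p + q"]) simp
next
  case (mult f g)
  then obtain p q where "\<forall>t. f (x + t *\<^sub>R d) = poly p t" "\<forall>t. g (x + t *\<^sub>R d) = poly q t"
    by blast
  then show ?case by (intro exI[of _ "p * q"]) simp
qed

lemma convex_on_line:
  fixes f :: "'a::real_vector \<Rightarrow> real"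
  assumes "convex_on UNIV f"
  shows "convex_on UNIV (\<lambda>t. f (x + t *\<^sub>R d))"
proof (rule convex_onI)
  fix u s t :: real
  assume "0 < u" "u < 1"
  have "x + ((1 - u) *\<^sub>R s + u *\<^sub>R t) *\<^sub>R d = (1 - u) *\<^sub>R (x + s *\<^sub>R d) + u *\<^sub>R (x + t *\<^sub>R d)"
    by (simp add: algebra_simps)
  with convex_onD[OF assms, of u "x + s *\<^sub>R d" "x + t *\<^sub>R d"] \<open>0 < u\<close> \<open>u < 1\<close>
  show "f (x + ((1 - u) *\<^sub>R s + u *\<^sub>R t) *\<^sub>R d) \<le> (1 - u) * f (x + s *\<^sub>R d) + u * f (x + t *\<^sub>R d)"
    by simp
qed simp

lemma convex_poly_bounded_above_imp_affine:
  fixes p :: "real poly"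
  assumes convex: "convex_on UNIV (poly p)" and bound: "\<And>t. t \<ge> 0 \<Longrightarrow> poly p t \<le> C"
  shows "\<exists>a b. p = [:a, b:]"
proof -
  obtain c q where p: "p = pCons c q"
    by (cases p)
  \<comment> \<open>\<open>poly q t\<close> is the slope of the chord of \<open>p\<close> from 0 to \<open>t\<close>; it stays bounded for \<open>t \<ge> 1\<close>.\<close>
  have upper: "poly q t \<le> \<bar>C - c\<bar>" if "t \<ge> 1" for t
  proof -
    have "t * poly q t \<le> \<bar>C - c\<bar>"
      using bound[of t] that by (simp add: p)
    also have "\<dots> \<le> t * \<bar>C - c\<bar>"
      using that by (simp add: mult_le_cancel_right1)
    finally show ?thesis
      using that by (simp add: mult_le_cancel_left)
  qed
  have lower: "poly q (-1) \<le> poly q t" if "t \<ge> 1" for t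
  proof -
    define w where "w = 1 / (1 + t)"
    have w: "w * t = 1 - w" "0 < w" "w < 1"
      using that by (simp_all add: w_def field_simps)
    have "c \<le> (1 - w) * (c - poly q (-1)) + w * (c + t * poly q t)"
      using convex_onD[OF convex, of w "-1" t] w by (simp add: p)
    also have "w * (c + t * poly q t) = w * c + (1 - w) * poly q t"
      unfolding w(1)[symmetric] by (simp add: algebra_simps)
    finally have "0 \<le> (1 - w) * (poly q t - poly q (-1))"
      by (simp add: algebra_simps)
    then show ?thesis
      using w by (simp add: zero_le_mult_iff)
  qed
  define K where "K = \<bar>C - c\<bar> + \<bar>poly q (-1)\<bar>"
  have K: "\<bar>poly q t\<bar> \<le> K" if "t \<ge> 1" for t
    using upper[OF that] lower[OF that] by (auto simp: K_def)
  have "degree q = 0"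
  proof (rule ccontr)
    assume "degree q \<noteq> 0"
    then have "filterlim (poly q) at_infinity at_infinity"
      by (intro filterlim_poly_at_infinity) auto
    then have "filterlim (poly q) at_infinity at_top"
      using filterlim_mono[OF _ order_refl at_top_le_at_infinity] by blast
    then have "eventually (\<lambda>t. K + 1 \<le> norm (poly q t)) at_top"
      by (simp add: filterlim_at_infinity[of 0] K_def)
    moreover have "eventually (\<lambda>t::real. t \<ge> 1) at_top"
      by (rule eventually_ge_at_top)
    ultimately have "eventually (\<lambda>t::real. False) at_top"
      by eventually_elim (use K in force)
    then show False by simp
  qed
  then obtain b where "q = [:b:]"
    by (rule degree_eq_zeroE)
  with p show ?thesis by blast
qed

lemma convex_poly_eq_chord_imp_affine:
  fixes p :: "real poly"
  assumes convex: "convex_on UNIV (poly p)" and v: "0 < v" "v < 1"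
    and eq: "poly p v = (1 - v) * poly p 0 + v * poly p 1"
  shows "\<exists>a b. p = [:a, b:]"
proof -
  define l where "l = [:poly p 0, poly p 1 - poly p 0:]"
  have "poly (p - l) t = 0" if t: "v < t" "t < 1" for t
  proof -
    have "poly p t \<le> poly l t"
      using convex_onD[OF convex, of t 0 1] t v by (simp add: l_def algebra_simps)
    \<comment> \<open>The point \<open>v\<close> lies between 0 and \<open>t\<close>, so \<open>p\<close> cannot be below the chord at \<open>t\<close>.\<close>
    have "poly p v \<le> (1 - v / t) * poly p 0 + v / t * poly p t"
      using convex_onD[OF convex, of "v / t" 0 t] t v by simp
    then have "v / t * (poly l t - poly p t) \<le> 0"
      using eq t v by (simp add: l_def field_simps)
    then have "poly l t \<le> poly p t"
      using t v by (simp add: mult_le_0_iff divide_le_0_iff)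
    with \<open>poly p t \<le> poly l t\<close> show ?thesis by simp
  qed
  then have "{v<..<1} \<subseteq> {t. poly (p - l) t = 0}"
    by auto
  moreover have "infinite {v<..<1}"
    using v by (simp add: infinite_Ioo)
  ultimately have "p - l = 0"
    using poly_roots_finite[of "p - l"] finite_subset by blast
  then show ?thesis by (auto simp: l_def)
qed

section \<open>Convex functions that are affine on a line\<close>

text \<open>
  A convex function has the same recession behaviour from every base point: the point
  \<open>z + t d\<close> is a limit of points on segments from \<open>z\<close> to points far out on the given line.
\<close>

lemma convex_affine_on_line_imp_translation:
  fixes f :: "'a::real_normed_vector \<Rightarrow> real"
  assumes convex: "convex_on UNIV f" and cont: "\<And>x. isCont f x"
    and affine: "\<And>t. f (x + t *\<^sub>R d) = a + b * t"
  shows "f (z + t *\<^sub>R d) = f z + b * t"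
proof -
  have le: "f (z + t *\<^sub>R d) \<le> f z + b * t" for z t
  proof (rule tendsto_le[where F = "at_right (0::real)"])
    have "((\<lambda>e. (1 - e) *\<^sub>R z + e *\<^sub>R x + t *\<^sub>R d) \<longlongrightarrow> (1 - 0) *\<^sub>R z + 0 *\<^sub>R x + t *\<^sub>R d) (at_right 0)"
      by (intro tendsto_intros)
    then show "((\<lambda>e. f ((1 - e) *\<^sub>R z + e *\<^sub>R x + t *\<^sub>R d)) \<longlongrightarrow> f (z + t *\<^sub>R d)) (at_right 0)"
      using isCont_tendsto_compose[OF cont] by fastforce
    have "((\<lambda>e. (1 - e) * f z + e * a + b * t) \<longlongrightarrow> (1 - 0) * f z + 0 * a + b * t) (at_right 0)"
      by (intro tendsto_intros)
    then show "((\<lambda>e. (1 - e) * f z + e * a + b * t) \<longlongrightarrow> f z + b * t) (at_right 0)"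
      by simp
    have "f ((1 - e) *\<^sub>R z + e *\<^sub>R x + t *\<^sub>R d) \<le> (1 - e) * f z + e * a + b * t"
      if "0 < e" "e < 1" for e
    proof -
      have "f ((1 - e) *\<^sub>R z + e *\<^sub>R (x + (t / e) *\<^sub>R d)) \<le> (1 - e) * f z + e * (a + b * (t / e))"
        using convex_onD[OF convex, of e z "x + (t / e) *\<^sub>R d"] that by (simp add: affine)
      then show ?thesis
        using that by (simp add: algebra_simps)
    qed
    moreover have "eventually (\<lambda>e::real. e \<in> {0<..<1}) (at_right 0)"
      by (rule eventually_at_right_real) simp
    ultimately show "eventually (\<lambda>e. f ((1 - e) *\<^sub>R z + e *\<^sub>R x + t *\<^sub>R d)
        \<le> (1 - e) * f z + e * a + b * t) (at_right 0)"
      by (auto elim: eventually_mono)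
  qed simp
  \<comment> \<open>The reverse inequality comes from translating back from \<open>z + t d\<close> to \<open>z\<close>.\<close>
  have "f z \<le> f (z + t *\<^sub>R d) - b * t"
    using le[of "z + t *\<^sub>R d" "- t"] by simp
  with le[of z t] show ?thesis by simp
qed

section \<open>Partial derivatives and the Hessian\<close>

lemma real_polynomial_function_directional_derivative:
  assumes "real_polynomial_function f"
  shows "\<exists>g. real_polynomial_function g \<and>
    (\<forall>x. ((\<lambda>t. f (x + t *\<^sub>R e)) has_real_derivative g x) (at 0))"
  using assms
proof induction
  case (linear f)
  then interpret bounded_linear f .
  have "((\<lambda>t. f (x + t *\<^sub>R e)) has_real_derivative f e) (at 0)" for x
    by (auto simp: add scaleR intro!: derivative_eq_intros)
  then show ?case by (intro exI[of _ "\<lambda>x. f e"]) auto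
next
  case (const c)
  show ?case by (intro exI[of _ "\<lambda>x. 0"]) auto
next
  case (add f g)
  then obtain f' g' where
    "real_polynomial_function f'" "\<forall>x. ((\<lambda>t. f (x + t *\<^sub>R e)) has_real_derivative f' x) (at 0)"
    "real_polynomial_function g'" "\<forall>x. ((\<lambda>t. g (x + t *\<^sub>R e)) has_real_derivative g' x) (at 0)"
    by blast
  then show ?case
    by (intro exI[of _ "\<lambda>x. f' x + g' x"]) (auto intro!: DERIV_add)
next
  case (mult f g)
  then obtain f' g' where
    "real_polynomial_function f'" "\<forall>x. ((\<lambda>t. f (x + t *\<^sub>R e)) has_real_derivative f' x) (at 0)"
    "real_polynomial_function g'" "\<forall>x. ((\<lambda>t. g (x + t *\<^sub>R e)) has_real_derivative g' x) (at 0)"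
    by blast
  with mult.hyps show ?case
    by (intro exI[of _ "\<lambda>x. f' x * g x + g' x * f x"]) (auto intro!: derivative_eq_intros)
qed

lemma real_polynomial_function_partial_deriv:
  fixes f :: "real ^ 'n::finite \<Rightarrow> real"
  assumes "real_polynomial_function f"
  shows "real_polynomial_function (partial_deriv i f)"
proof -
  obtain g where g: "real_polynomial_function g"
    "\<And>x. ((\<lambda>t. f (x + t *\<^sub>R axis i 1)) has_real_derivative g x) (at 0)"
    using real_polynomial_function_directional_derivative[OF assms] by blast
  have "partial_deriv i f = g"
    by (rule ext) (simp add: partial_deriv_def DERIV_imp_deriv[OF g(2)])
  with g(1) show ?thesis by simp
qed

lemma has_real_derivative_along_line:
  fixes g :: "'a::real_normed_vector \<Rightarrow> real"
  assumes "(g has_derivative D) (at x)"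
  shows "((\<lambda>t. g (x + t *\<^sub>R d)) has_real_derivative D d) (at 0)"
proof -
  have "((\<lambda>t. x + t *\<^sub>R d) has_derivative (\<lambda>t. t *\<^sub>R d)) (at (0::real))"
    by (auto intro!: derivative_eq_intros)
  moreover have "(g has_derivative D) (at (x + 0 *\<^sub>R d))"
    using assms by simp
  ultimately have "((\<lambda>t. g (x + t *\<^sub>R d)) has_derivative (\<lambda>t. D (t *\<^sub>R d))) (at 0)"
    by (rule has_derivative_compose)
  moreover have "D (t *\<^sub>R d) = D d * t" for t
    using linear_scale[OF has_derivative_linear[OF assms]] by simp
  ultimately show ?thesis
    by (simp add: has_field_derivative_def)
qed

lemma deriv_along_line_eq_sum_partial_deriv:
  fixes g :: "real ^ 'n::finite \<Rightarrow> real"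
  assumes "g differentiable (at x)"
  shows "deriv (\<lambda>t. g (x + t *\<^sub>R d)) 0 = (\<Sum>i\<in>UNIV. d $ i * partial_deriv i g x)"
proof -
  obtain D where D: "(g has_derivative D) (at x)"
    using assms by (auto simp: differentiable_def)
  have line: "deriv (\<lambda>t. g (x + t *\<^sub>R e)) 0 = D e" for e
    by (rule DERIV_imp_deriv[OF has_real_derivative_along_line[OF D]])
  have "D d = D (\<Sum>i\<in>UNIV. d $ i *\<^sub>R axis i 1)"
    by (simp add: basis_expansion flip: scalar_mult_eq_scaleR)
  also have "\<dots> = (\<Sum>i\<in>UNIV. d $ i * D (axis i 1))"
    using has_derivative_linear[OF D] by (simp add: linear_sum linear_scale)
  finally show ?thesis
    by (simp add: line partial_deriv_def)
qed

lemma hessian_left_kernel_of_translation: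
  fixes f :: "real ^ 'n::finite \<Rightarrow> real"
  assumes poly: "real_polynomial_function f"
    and trans: "\<And>z t. f (z + t *\<^sub>R d) = f z + b * t"
  shows "d v* hessian f x = 0"
proof -
  have "(d v* hessian f x) $ j = 0" for j
  proof -
    let ?g = "partial_deriv j f"
    have "?g (x + t *\<^sub>R d) = ?g x" for t
    proof -
      obtain g where g: "\<And>x. ((\<lambda>s. f (x + s *\<^sub>R axis j 1)) has_real_derivative g x) (at 0)"
        using real_polynomial_function_directional_derivative[OF poly] by blast
      have "(\<lambda>s. f (x + t *\<^sub>R d + s *\<^sub>R axis j 1)) = (\<lambda>s. f (x + s *\<^sub>R axis j 1) + b * t)"
        using trans[of "x + _ *\<^sub>R axis j 1" t] by (simp add: algebra_simps)
      moreover have "((\<lambda>s. f (x + s *\<^sub>R axis j 1) + b * t) has_real_derivative g x) (at 0)"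
        using DERIV_add[OF g[of x] DERIV_const[of "b * t"]] by simp
      ultimately show ?thesis
        using g[of x] by (simp add: partial_deriv_def DERIV_imp_deriv)
    qed
    then have "(\<Sum>i\<in>UNIV. d $ i * partial_deriv i ?g x) = 0"
      using deriv_along_line_eq_sum_partial_deriv[of ?g x d]
        differentiable_at_real_polynomial_function[OF real_polynomial_function_partial_deriv[OF poly]]
      by simp
    then show ?thesis
      by (simp add: vector_matrix_mult_def hessian_def mult.commute)
  qed
  then show ?thesis
    by (simp add: vec_eq_iff)
qed

lemma convex_polynomial_not_affine_on_line:
  fixes f :: "real ^ 'n::finite \<Rightarrow> real"
  assumes poly: "real_polynomial_function f" and convex: "convex_on UNIV f"
    and pos: "pos_definite (hessian f x0)" and "d \<noteq> 0"
    and affine: "\<And>t. f (x + t *\<^sub>R d) = a + b * t"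
  shows False
proof -
  have "f (z + t *\<^sub>R d) = f z + b * t" for z t
    by (rule convex_affine_on_line_imp_translation[OF convex
          continuous_real_polymonial_function[OF poly] affine])
  then have "d v* hessian f x0 = 0"
    by (rule hessian_left_kernel_of_translation[OF poly])
  then have "d \<bullet> (hessian f x0 *v d) = 0"
    by (simp flip: dot_lmul_matrix)
  with pos \<open>d \<noteq> 0\<close> show False
    by (auto simp: pos_definite_def)
qed

section \<open>Coercivity and strict convexity\<close>

lemma convex_not_coercive_imp_bounded_above_on_ray:
  fixes f :: "'a::euclidean_space \<Rightarrow> real"
  assumes convex: "convex_on UNIV f" and cont: "\<And>x. isCont f x" and "\<not> coercive f"
  shows "\<exists>d C. d \<noteq> 0 \<and> (\<forall>t\<ge>0. f (t *\<^sub>R d) \<le> C)"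
proof -
  have "\<not> ((\<lambda>x. ereal (f x)) \<longlongrightarrow> \<infinity>) at_infinity"
    using assms(3) Liminf_PInfty[of at_infinity "\<lambda>x. ereal (f x)"]
    by (simp add: coercive_def trivial_limit_at_infinity)
  then obtain C where C: "\<not> eventually (\<lambda>x. C < f x) at_infinity"
    by (auto simp: tendsto_PInfty)
  have "\<exists>x. norm x \<ge> real (Suc k) \<and> f x \<le> C" for k
    using C by (auto simp: eventually_at_infinity not_less)
  then obtain X where X: "\<And>k. norm (X k) \<ge> real (Suc k)" "\<And>k. f (X k) \<le> C"
    by metis
  have X0: "norm (X k) > 0" for k
    using X(1)[of k] by linarith
  have "compact (sphere (0::'a) 1)"
    by simp
  moreover have "\<forall>k. X k /\<^sub>R norm (X k) \<in> sphere 0 1"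
    using X0 by simp
  ultimately obtain d r where d: "d \<in> sphere 0 1" and r: "strict_mono (r :: nat \<Rightarrow> nat)"
    and lim: "((\<lambda>k. X k /\<^sub>R norm (X k)) \<circ> r) \<longlonglongrightarrow> d"
    unfolding compact_def by meson
  have "f (t *\<^sub>R d) \<le> max (f 0) C" if "t \<ge> 0" for t
  proof (rule tendsto_upperbound)
    show "(\<lambda>k. f (t *\<^sub>R (X (r k) /\<^sub>R norm (X (r k))))) \<longlonglongrightarrow> f (t *\<^sub>R d)"
      using lim by (intro isCont_tendsto_compose[OF cont] tendsto_scaleR tendsto_const)
        (simp add: o_def)
    have "f (t *\<^sub>R (X (r k) /\<^sub>R norm (X (r k)))) \<le> max (f 0) C" if k: "k \<ge> nat \<lceil>t\<rceil>" for k
    proof -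
      \<comment> \<open>For large \<open>k\<close> the point at distance \<open>t\<close> lies on the segment from 0 to \<open>X (r k)\<close>.\<close>
      have "t \<le> norm (X (r k))"
        using k X(1)[of "r k"] seq_suble[OF r, of k] by linarith
      define u where "u = t / norm (X (r k))"
      have u: "0 \<le> u" "u \<le> 1"
        using \<open>t \<ge> 0\<close> \<open>t \<le> norm (X (r k))\<close> X0[of "r k"] by (auto simp: u_def)
      have "f (u *\<^sub>R X (r k)) \<le> (1 - u) * f 0 + u * f (X (r k))"
        using convex_onD[OF convex, of u 0 "X (r k)"] u by simp
      also have "\<dots> \<le> (1 - u) * max (f 0) C + u * max (f 0) C"
        using u X(2)[of "r k"] by (intro add_mono mult_left_mono) auto
      finally show ?thesis
        by (simp add: u_def divide_inverse algebra_simps)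
    qed
    then show "eventually (\<lambda>k. f (t *\<^sub>R (X (r k) /\<^sub>R norm (X (r k)))) \<le> max (f 0) C) sequentially"
      by (rule eventually_sequentiallyI)
  qed simp
  moreover have "d \<noteq> 0"
    using d by auto
  ultimately show ?thesis by blast
qed

theorem lemma3p1:
  fixes f :: "real ^ 'n::finite \<Rightarrow> real" and x0 :: "real ^ 'n"
  assumes "real_polynomial_function f"
    and "convex_on UNIV f"
    and "pos_definite (hessian f x0)"
  shows "coercive f \<and> strictly_convex_on UNIV f"
proof
  note no_affine = convex_polynomial_not_affine_on_line[OF assms]
  have cont: "isCont f x" for x
    by (rule continuous_real_polymonial_function[OF assms(1)])
  show "coercive f"
  proof (rule ccontr)
    assume "\<not> coercive f"
    then obtain d C where d: "d \<noteq> 0" and C: "\<And>t. t \<ge> 0 \<Longrightarrow> f (t *\<^sub>R d) \<le> C"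
      using convex_not_coercive_imp_bounded_above_on_ray[OF assms(2) cont] by blast
    obtain p where p: "\<And>t. f (0 + t *\<^sub>R d) = poly p t"
      using real_polynomial_function_on_line[OF assms(1)] by blast
    have "convex_on UNIV (poly p)"
      using convex_on_line[OF assms(2), of 0 d] by (simp only: p)
    moreover have "poly p t \<le> C" if "t \<ge> 0" for t
      using C[OF that] p[of t] by simp
    ultimately obtain a b where "p = [:a, b:]"
      using convex_poly_bounded_above_imp_affine by blast
    then show False
      using no_affine[OF d, of 0 a b] p by (simp add: mult.commute)
  qed
  show "strictly_convex_on UNIV f"
    unfolding strictly_convex_on_def
  proof (intro conjI ballI allI impI)
    fix x y :: "real ^ 'n" and u v :: real
    assume uv: "u > 0" "v > 0" "u + v = 1" and "x \<noteq> y"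
    obtain p where p: "\<And>t. f (x + t *\<^sub>R (y - x)) = poly p t"
      using real_polynomial_function_on_line[OF assms(1)] by blast
    have convex: "convex_on UNIV (poly p)"
      using convex_on_line[OF assms(2), of x "y - x"] by (simp only: p)
    have u: "u = 1 - v"
      using uv by simp
    have pt: "f x = poly p 0" "f y = poly p 1" "f (u *\<^sub>R x + v *\<^sub>R y) = poly p v"
      using p[of 0] p[of 1] p[of v] by (simp_all add: u algebra_simps)
    have "poly p v \<le> (1 - v) * poly p 0 + v * poly p 1"
      using convex_onD[OF convex, of v 0 1] uv by simp
    moreover have "poly p v \<noteq> (1 - v) * poly p 0 + v * poly p 1"
    proof
      assume "poly p v = (1 - v) * poly p 0 + v * poly p 1"
      then obtain a b where "p = [:a, b:]"
        using convex_poly_eq_chord_imp_affine[OF convex, of v] uv by auto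
      then show False
        using no_affine[of "y - x" x a b] p \<open>x \<noteq> y\<close> by (simp add: mult.commute)
    qed
    ultimately show "f (u *\<^sub>R x + v *\<^sub>R y) < u * f x + v * f y"
      unfolding pt by (simp add: u)
  qed simp
qed

end
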